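(* Let $n\in\{0,1,2\}$, $\gamma>1$, $0\le\alpha\le1$. Consider, on a uniform orthogonal mesh in the mass Lagrangian coordinates $(t,s)$, the Samarskii–Popov scheme $$\Big(\frac1\rho\Big)_t=(Ru^{(0.5)})_s,\qquad u_t=-R\,p_{\bar s}^{(\alpha)},\qquad \varepsilon_t=-p^{(\alpha)}(Ru^{(0.5)})_s,\qquad r_t=u^{(0.5)},$$ with $R=\frac{\hat r^{\,n+1}-r^{\,n+1}}{(n+1)(\hat r-r)}$ (that is, $R=1$, $\frac{\hat r+r}{2}$, $\frac{\hat r^2+\hat rr+r^2}{3}$ for $n=0,1,2$), supplemented by the polytropic equation of state $\varepsilon=\frac{p}{(\gamma-1)\rho}$ at every cell midpoint and time layer. Then: (a) the scheme is invariant with respect to $$X_0=\partial_s,\quad X_1=\partial_t,\quad X_2=t\partial_t+(n+1)s\partial_s+r\partial_r,\quad X_3=2t\partial_t+(n+3)s\partial_s-u\partial_u+2\rho\partial_\rho+r\partial_r,\quad X_4=s\partial_s+\rho\partial_\rho+p\partial_p;$$ (b) for $n=0$ it is also invariant with respect to $\partial_r$ and $t\partial_r+\partial_u$; (c) for $\gamma=\frac{n+3}{n+1}$ it is not invariant with respect to $$X_{*,\gamma}=t^2\partial_t+(r-tu)\partial_u-(n+1)t\rho\,\partial_\rho-(n+3)tp\,\partial_p+tr\,\partial_r .$$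
   Context: Notation: time layers $t=t_j$, $\hat t=t_{j+1}=t+\tau$; mesh points $s_i$ with $s_{i+1}-s_i=h^s$. Node variables: $u=u_i^j$, $u_+=u_{i+1}^j$, $\hat u=u_i^{j+1}$, and similarly $r$. Midpoint variables ($\rho,p>0$, $\varepsilon$): $p=p_{i+1/2}^j$, $p_-=p_{i-1/2}^j$, $\hat p=p_{i+1/2}^{j+1}$, etc. Differences: $f_t=(\hat f-f)/\tau$, $f_s=(f_+-f)/h^s$ for node quantities, $p_{\bar s}=(p-p_-)/h^s$; weighted values $y^{(\alpha)}=\alpha\hat y+(1-\alpha)y$. For $n\ge1$, $r>0$. A generator acts simultaneously on all mesh variables: the coefficient for each stencil variable is obtained by evaluating at the node/midpoint and time layer of that variable (so $\tau$ and $h^s$ transform as differences of transformed coordinates, and $\varepsilon$ is expressed through $p,\rho$); the scheme is invariant under a generator if its (local) one-parameter group maps the set of stencil values satisfying the scheme equations into itself. *)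

theory Defs
  imports Complex_Main
begin

text \<open>
  Values on the stencil of the scheme, indexed by offsets relative to the base node \<open>i\<close> and the base
  layer \<open>j\<close>.  Layer offsets are 0 (layer \<open>t\<close>) and 1 (the hatted layer).  The node offset \<open>k\<close>
  denotes the node \<open>i + k\<close>, the midpoint offset \<open>k\<close> denotes \<open>i + k + 1/2\<close>, so that \<open>p\<^sub>-\<close> is
  \<open>st_p z (-1) 0\<close>.  Only the offsets in the sets below belong to the stencil.  The mesh is
  orthogonal because \<open>st_t\<close> depends on the layer only and \<open>st_s\<close> on the node only.
\<close>

record stencil =
  st_t :: "nat \<Rightarrow> real"
  st_s :: "int \<Rightarrow> real"
  st_u :: "int \<Rightarrow> nat \<Rightarrow> real"
  st_r :: "int \<Rightarrow> nat \<Rightarrow> real"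
  st_rho :: "int \<Rightarrow> nat \<Rightarrow> real"
  st_p :: "int \<Rightarrow> nat \<Rightarrow> real"

abbreviation layers :: "nat set" where "layers \<equiv> {0, 1}"
abbreviation s_nodes :: "int set" where "s_nodes \<equiv> {-1, 0, 1}"
abbreviation nodes :: "int set" where "nodes \<equiv> {0, 1}"
abbreviation midpoints :: "int set" where "midpoints \<equiv> {-1, 0}"

definition tau :: "stencil \<Rightarrow> real" where
  "tau z = st_t z 1 - st_t z 0"

definition hs :: "stencil \<Rightarrow> real" where
  "hs z = st_s z 1 - st_s z 0"

definition s_mid :: "stencil \<Rightarrow> int \<Rightarrow> real" where
  "s_mid z k = (st_s z k + st_s z (k + 1)) / 2"

definition diff_t :: "stencil \<Rightarrow> (int \<Rightarrow> nat \<Rightarrow> real) \<Rightarrow> int \<Rightarrow> real" where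
  "diff_t z f k = (f k 1 - f k 0) / tau z"

definition diff_s :: "stencil \<Rightarrow> (int \<Rightarrow> real) \<Rightarrow> int \<Rightarrow> real" where
  "diff_s z g k = (g (k + 1) - g k) / hs z"

definition diff_sbar :: "stencil \<Rightarrow> (int \<Rightarrow> real) \<Rightarrow> int \<Rightarrow> real" where
  "diff_sbar z g k = (g k - g (k - 1)) / hs z"

definition weighted :: "real \<Rightarrow> (int \<Rightarrow> nat \<Rightarrow> real) \<Rightarrow> int \<Rightarrow> real" where
  "weighted \<alpha> f k = \<alpha> * f k 1 + (1 - \<alpha>) * f k 0"

text \<open>The difference quotient is extended by its limit where the two radii coincide.\<close>

definition R_quot :: "nat \<Rightarrow> real \<Rightarrow> real \<Rightarrow> real" where
  "R_quot n r rh =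
     (if rh = r then r ^ n else (rh ^ (n + 1) - r ^ (n + 1)) / (real (n + 1) * (rh - r)))"

lemma R_quot_explicit:
  "R_quot 0 r rh = 1"
  "R_quot 1 r rh = (rh + r) / 2"
  "R_quot 2 r rh = (rh\<^sup>2 + rh * r + r\<^sup>2) / 3"
  by (auto simp: R_quot_def numeral_2_eq_2 numeral_3_eq_3 power2_eq_square divide_simps,
      (simp add: algebra_simps)+)

definition R_node :: "nat \<Rightarrow> stencil \<Rightarrow> int \<Rightarrow> real" where
  "R_node n z k = R_quot n (st_r z k 0) (st_r z k 1)"

definition eps :: "real \<Rightarrow> stencil \<Rightarrow> int \<Rightarrow> nat \<Rightarrow> real" where
  "eps \<gamma> z k j = st_p z k j / ((\<gamma> - 1) * st_rho z k j)"

text \<open>The space of stencil values on which the scheme is considered and the local groups act.\<close>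

definition admissible :: "nat \<Rightarrow> stencil \<Rightarrow> bool" where
  "admissible n z \<longleftrightarrow>
     tau z > 0 \<and> hs z > 0 \<and>
     (\<forall>k\<in>midpoints. \<forall>j\<in>layers. st_rho z k j > 0 \<and> st_p z k j > 0) \<and>
     (n \<ge> 1 \<longrightarrow> (\<forall>k\<in>nodes. \<forall>j\<in>layers. st_r z k j > 0))"

text \<open>The first conjunct after admissibility is the uniformity of the mesh in \<open>s\<close>.\<close>

definition samarskii_popov :: "nat \<Rightarrow> real \<Rightarrow> real \<Rightarrow> stencil set" where
  "samarskii_popov n \<gamma> \<alpha> = {z. admissible n z \<and>
     st_s z 1 - st_s z 0 = st_s z 0 - st_s z (-1) \<and>
     diff_t z (\<lambda>k j. 1 / st_rho z k j) 0
       = diff_s z (\<lambda>k. R_node n z k * weighted (1/2) (st_u z) k) 0 \<and>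
     diff_t z (st_u z) 0 = - R_node n z 0 * diff_sbar z (weighted \<alpha> (st_p z)) 0 \<and>
     diff_t z (eps \<gamma> z) 0
       = - weighted \<alpha> (st_p z) 0 * diff_s z (\<lambda>k. R_node n z k * weighted (1/2) (st_u z) k) 0 \<and>
     diff_t z (st_r z) 0 = weighted (1/2) (st_u z) 0}"

text \<open>
  Generators \<open>ct \<partial>\<^sub>t + cs \<partial>\<^sub>s + cu \<partial>\<^sub>u + cr \<partial>\<^sub>r + crho \<partial>\<^sub>\<rho> + cp \<partial>\<^sub>p\<close>.  The coefficients of the node
  variables take the arguments \<open>t s u r\<close> and those of the midpoint variables \<open>t s \<rho> p\<close>, so they can
  be evaluated at the mesh point where the variable is located.
\<close>

record generator =
  ct :: "real \<Rightarrow> real"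
  cs :: "real \<Rightarrow> real"
  cu :: "real \<Rightarrow> real \<Rightarrow> real \<Rightarrow> real \<Rightarrow> real"
  cr :: "real \<Rightarrow> real \<Rightarrow> real \<Rightarrow> real \<Rightarrow> real"
  crho :: "real \<Rightarrow> real \<Rightarrow> real \<Rightarrow> real \<Rightarrow> real"
  cp :: "real \<Rightarrow> real \<Rightarrow> real \<Rightarrow> real \<Rightarrow> real"

text \<open>
  An orbit of the local one-parameter group generated by \<open>X\<close>: an integral curve, in the space of
  admissible stencil values, of the prolongation of \<open>X\<close> to all stencil variables.
\<close>

definition orbit :: "nat \<Rightarrow> generator \<Rightarrow> real set \<Rightarrow> (real \<Rightarrow> stencil) \<Rightarrow> bool" where
  "orbit n X I \<phi> \<longleftrightarrow>
     open I \<and> connected I \<and> 0 \<in> I \<and>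
     (\<forall>a\<in>I. admissible n (\<phi> a) \<and>
       (\<forall>j\<in>layers. ((\<lambda>b. st_t (\<phi> b) j) has_real_derivative ct X (st_t (\<phi> a) j)) (at a)) \<and>
       (\<forall>k\<in>s_nodes. ((\<lambda>b. st_s (\<phi> b) k) has_real_derivative cs X (st_s (\<phi> a) k)) (at a)) \<and>
       (\<forall>k\<in>nodes. \<forall>j\<in>layers.
         ((\<lambda>b. st_u (\<phi> b) k j) has_real_derivative
            cu X (st_t (\<phi> a) j) (st_s (\<phi> a) k) (st_u (\<phi> a) k j) (st_r (\<phi> a) k j)) (at a) \<and>
         ((\<lambda>b. st_r (\<phi> b) k j) has_real_derivative
            cr X (st_t (\<phi> a) j) (st_s (\<phi> a) k) (st_u (\<phi> a) k j) (st_r (\<phi> a) k j)) (at a)) \<and>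
       (\<forall>k\<in>midpoints. \<forall>j\<in>layers.
         ((\<lambda>b. st_rho (\<phi> b) k j) has_real_derivative
            crho X (st_t (\<phi> a) j) (s_mid (\<phi> a) k) (st_rho (\<phi> a) k j) (st_p (\<phi> a) k j)) (at a) \<and>
         ((\<lambda>b. st_p (\<phi> b) k j) has_real_derivative
            cp X (st_t (\<phi> a) j) (s_mid (\<phi> a) k) (st_rho (\<phi> a) k j) (st_p (\<phi> a) k j)) (at a)))"

definition scheme_invariant :: "nat \<Rightarrow> real \<Rightarrow> real \<Rightarrow> generator \<Rightarrow> bool" where
  "scheme_invariant n \<gamma> \<alpha> X \<longleftrightarrow>
     (\<forall>I \<phi>. orbit n X I \<phi> \<and> \<phi> 0 \<in> samarskii_popov n \<gamma> \<alpha> \<longrightarrow>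
        (\<forall>a\<in>I. \<phi> a \<in> samarskii_popov n \<gamma> \<alpha>))"

definition zero_gen :: generator where
  "zero_gen = \<lparr>ct = (\<lambda>t. 0), cs = (\<lambda>s. 0),
     cu = (\<lambda>t s u r. 0), cr = (\<lambda>t s u r. 0),
     crho = (\<lambda>t s \<rho> p. 0), cp = (\<lambda>t s \<rho> p. 0)\<rparr>"

definition X0 :: generator where
  "X0 = zero_gen\<lparr>cs := \<lambda>s. 1\<rparr>"

definition X1 :: generator where
  "X1 = zero_gen\<lparr>ct := \<lambda>t. 1\<rparr>"

definition X2 :: "nat \<Rightarrow> generator" where
  "X2 n = zero_gen\<lparr>ct := \<lambda>t. t, cs := \<lambda>s. real (n + 1) * s, cr := \<lambda>t s u r. r\<rparr>"

definition X3 :: "nat \<Rightarrow> generator" where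
  "X3 n = zero_gen\<lparr>ct := \<lambda>t. 2 * t, cs := \<lambda>s. real (n + 3) * s, cu := \<lambda>t s u r. - u,
     crho := \<lambda>t s \<rho> p. 2 * \<rho>, cr := \<lambda>t s u r. r\<rparr>"

definition X4 :: generator where
  "X4 = zero_gen\<lparr>cs := \<lambda>s. s, crho := \<lambda>t s \<rho> p. \<rho>, cp := \<lambda>t s \<rho> p. p\<rparr>"

definition X_shift_r :: generator where
  "X_shift_r = zero_gen\<lparr>cr := \<lambda>t s u r. 1\<rparr>"

definition X_galilei :: generator where
  "X_galilei = zero_gen\<lparr>cr := \<lambda>t s u r. t, cu := \<lambda>t s u r. 1\<rparr>"

definition X_star :: "nat \<Rightarrow> generator" where
  "X_star n = zero_gen\<lparr>ct := \<lambda>t. t\<^sup>2, cu := \<lambda>t s u r. r - t * u,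
     crho := \<lambda>t s \<rho> p. - real (n + 1) * t * \<rho>, cp := \<lambda>t s \<rho> p. - real (n + 3) * t * p,
     cr := \<lambda>t s u r. t * r\<rparr>"

end

(* X0, ..., X4 generate shifts of t and s and scalings.  If the time step is multiplied by A, u by C
   and rho by D, the equations keep their form exactly when r scales by AC, the mass step by
   D (AC)^(n+1) and p by C^2 D.  For n = 0 one has R = 1 and only differences of r and u and the
   balance r_t = u^(0.5) matter, which gives the shift of r and the Galilei boost.  The flow of the
   last generator breaks the equation r_t = u^(0.5): it adds a r to the left-hand side and
   a (r + (r^ - tau u^)) / 2 to the right-hand side, so the equation survives only if u^ = u, and a
   pressure jump across the node makes u^ differ from u. *)
theory Submission imports Defs "HOL-Analysis.Henstock_Kurzweil_Integration" begin

section \<open>Integration of linear flows along an orbit\<close>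

text \<open>The product of \<open>f\<close> with \<open>exp (- c * b)\<close> has derivative zero,
  hence is constant on the connected open set \<open>I\<close>. Invariance quantifies over all
  orbits, so this uniqueness statement is what reduces an arbitrary orbit to an explicit
  scaling.\<close>

lemma exponential_growth:
  fixes f :: "real \<Rightarrow> real"
  assumes "open I" "connected I" "0 \<in> I" "a \<in> I"
    and deriv: "\<And>b. b \<in> I \<Longrightarrow> (f has_real_derivative c * f b) (at b)"
  shows "f a = exp (c * a) * f 0"
proof -
  let ?g = "\<lambda>b. f b * exp (- c * b)"
  have *: "(?g has_real_derivative 0) (at b)" if "b \<in> I" for b
    by (rule derivative_eq_intros deriv that refl | simp add: algebra_simps)+
  have "?g constant_on I"
    using has_field_derivative_0_imp_constant_on[of I ?g] * assms(1,2) by blast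
  then have "?g a = ?g 0" using assms(3,4) unfolding constant_on_def by metis
  then have "f a * (exp (- c * a) * exp (c * a)) = f 0 * exp (c * a)"
    by (simp add: mult.assoc)
  then show ?thesis by (simp flip: exp_add add: mult.commute)
qed

lemma linear_growth:
  fixes f :: "real \<Rightarrow> real"
  assumes "open I" "connected I" "0 \<in> I" "a \<in> I"
    and deriv: "\<And>b. b \<in> I \<Longrightarrow> (f has_real_derivative c) (at b)"
  shows "f a = f 0 + c * a"
proof -
  have "((\<lambda>b. f b - c * b) has_real_derivative 0 * (f b - c * b)) (at b)" if "b \<in> I" for b
    by (rule derivative_eq_intros deriv that refl | simp)+
  from exponential_growth[OF assms(1-4) this] show ?thesis by simp
qed

section \<open>Scalings, and shifts of time and mass\<close>

text \<open>The quotient is homogeneous of degree \<open>n\<close>. A nonzero factor keeps equal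
  radii equal and distinct radii distinct, so both sides fall into the same branch of
  \<open>R_quot\<close>.\<close>

lemma R_quot_scale:
  assumes "l \<noteq> 0"
  shows "R_quot n (l * r) (l * rh) = l ^ n * R_quot n r rh"
proof (cases "rh = r")
  case False
  have "(l * rh) ^ (n + 1) - (l * r) ^ (n + 1) = l * (l ^ n * (rh ^ (n + 1) - r ^ (n + 1)))"
    by (simp add: algebra_simps power_mult_distrib)
  moreover have "real (n + 1) * (l * rh - l * r) = l * (real (n + 1) * (rh - r))"
    by (simp add: algebra_simps)
  ultimately show ?thesis using False assms by (simp add: R_quot_def)
qed (use assms in \<open>simp add: R_quot_def power_mult_distrib\<close>)

text \<open>Both sides of each balance pick up the same factor: \<open>1 / (A * D)\<close> for mass,
  \<open>C / A\<close> for momentum, \<open>C\<^sup>2 / A\<close> for energy and \<open>C\<close>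
  for the radius. The value of \<open>B\<close> balances mass; the factor of \<open>p\<close> then
  balances momentum, and energy agrees because the internal energy scales like the square of the
  velocity. The cell at -1 enters only through the uniformity of the mesh.\<close>

lemma samarskii_popov_scale:
  assumes z: "z \<in> samarskii_popov n \<gamma> \<alpha>" and adm: "admissible n z'"
    and pos: "A > 0" "C > 0" "D > 0"
    and B: "B = D * (A * C) ^ (n + 1)"
    and tau: "tau z' = A * tau z"
    and s: "\<And>k. k \<in> {-1, 0} \<Longrightarrow> st_s z' (k + 1) - st_s z' k = B * (st_s z (k + 1) - st_s z k)"
    and u: "\<And>k j. k \<in> nodes \<Longrightarrow> j \<in> layers \<Longrightarrow> st_u z' k j = C * st_u z k j"
    and r: "\<And>k j. k \<in> nodes \<Longrightarrow> j \<in> layers \<Longrightarrow> st_r z' k j = A * C * st_r z k j"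
    and rho: "\<And>k j. k \<in> midpoints \<Longrightarrow> j \<in> layers \<Longrightarrow> st_rho z' k j = D * st_rho z k j"
    and p: "\<And>k j. k \<in> midpoints \<Longrightarrow> j \<in> layers \<Longrightarrow> st_p z' k j = C\<^sup>2 * D * st_p z k j"
  shows "z' \<in> samarskii_popov n \<gamma> \<alpha>"
proof -
  have hs: "hs z' = B * hs z" using s[of 0] by (simp add: hs_def)
  have R: "R_node n z' k = (A * C) ^ n * R_node n z k" if "k \<in> nodes" for k
    using that pos by (simp add: R_node_def r R_quot_scale)
  have w: "weighted (1/2) (st_u z') k = C * weighted (1/2) (st_u z) k" if "k \<in> nodes" for k
    using that by (auto simp: weighted_def u algebra_simps)
  have wp: "weighted \<alpha> (st_p z') k = C\<^sup>2 * D * weighted \<alpha> (st_p z) k" if "k \<in> midpoints" for k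
    using that by (auto simp: weighted_def p algebra_simps)
  \<comment> \<open>This is the volume flux difference shared by the mass and energy
    equations.\<close>
  define F where "F z = diff_s z (\<lambda>k. R_node n z k * weighted (1/2) (st_u z) k) 0" for z
  have "F z' = ((A * C) ^ n * C / B) * F z"
    by (simp add: F_def diff_s_def R w hs algebra_simps diff_divide_distrib)
  \<comment> \<open>\<open>B\<close> carries one factor \<open>A * C\<close> more than
    \<open>R\<close> supplies, which turns the velocity factor \<open>C\<close> into
    \<open>1 / A\<close>.\<close>
  also have "(A * C) ^ n * C / B = 1 / (A * D)"
    using pos by (simp add: B)
  finally have F: "F z' = F z / (A * D)" by simp
  have v: "diff_t z' (\<lambda>k j. 1 / st_rho z' k j) 0
      = diff_t z (\<lambda>k j. 1 / st_rho z k j) 0 / (A * D)"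
    by (simp add: diff_t_def rho tau diff_divide_distrib algebra_simps)
  have u_t: "diff_t z' (st_u z') 0 = (C / A) * diff_t z (st_u z) 0"
    by (simp add: diff_t_def u tau diff_divide_distrib algebra_simps)
  have "R_node n z' 0 * diff_sbar z' (weighted \<alpha> (st_p z')) 0
      = ((A * C) ^ n * (C\<^sup>2 * D) / B) * (R_node n z 0 * diff_sbar z (weighted \<alpha> (st_p z)) 0)"
    by (simp add: diff_sbar_def R wp hs algebra_simps diff_divide_distrib)
  also have "(A * C) ^ n * (C\<^sup>2 * D) / B = C / A"
    using pos by (simp add: B power2_eq_square)
  finally have p_s: "R_node n z' 0 * diff_sbar z' (weighted \<alpha> (st_p z')) 0
      = (C / A) * (R_node n z 0 * diff_sbar z (weighted \<alpha> (st_p z)) 0)" .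
  have eps: "eps \<gamma> z' 0 j = C\<^sup>2 * eps \<gamma> z 0 j" if "j \<in> layers" for j
    using that pos by (auto simp: eps_def p rho)
  have e_t: "diff_t z' (eps \<gamma> z') 0 = (C\<^sup>2 / A) * diff_t z (eps \<gamma> z) 0"
    by (simp add: diff_t_def eps tau diff_divide_distrib algebra_simps)
  have r_t: "diff_t z' (st_r z') 0 = C * diff_t z (st_r z) 0"
    using pos by (simp add: diff_t_def r tau diff_divide_distrib algebra_simps)
  have z_eqs: "st_s z 1 - st_s z 0 = st_s z 0 - st_s z (-1)"
      "diff_t z (\<lambda>k j. 1 / st_rho z k j) 0 = F z"
      "diff_t z (st_u z) 0 = - (R_node n z 0 * diff_sbar z (weighted \<alpha> (st_p z)) 0)"
      "diff_t z (eps \<gamma> z) 0 = - (weighted \<alpha> (st_p z) 0 * F z)"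
      "diff_t z (st_r z) 0 = weighted (1/2) (st_u z) 0"
    using z by (simp_all add: samarskii_popov_def F_def)
  have "st_s z' 1 - st_s z' 0 = st_s z' 0 - st_s z' (-1)"
    using s[of 0] s[of "-1"] z_eqs(1) by simp
  moreover have "diff_t z' (\<lambda>k j. 1 / st_rho z' k j) 0 = F z'"
    by (simp only: v F z_eqs(2))
  moreover have "diff_t z' (st_u z') 0
      = - (R_node n z' 0 * diff_sbar z' (weighted \<alpha> (st_p z')) 0)"
    by (simp only: u_t p_s z_eqs(3) mult_minus_right)
  moreover have "diff_t z' (eps \<gamma> z') 0 = - (weighted \<alpha> (st_p z') 0 * F z')"
    using pos by (simp add: e_t F wp z_eqs(4))
  moreover have "diff_t z' (st_r z') 0 = weighted (1/2) (st_u z') 0"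
    by (simp add: r_t w z_eqs(5))
  ultimately show ?thesis
    using adm by (simp add: samarskii_popov_def F_def)
qed

text \<open>Here \<open>a\<close>, \<open>c\<close>, \<open>d\<close> are the logarithmic rates of
  t, u, \<rho>; the rates of r, s and p are those forced by compatibility with the scheme. The
  shifts \<open>t0\<close> and \<open>s0\<close> are included so that translations and scalings
  share one invariance proof.\<close>

definition scaling_gen ::
    "nat \<Rightarrow> real \<Rightarrow> real \<Rightarrow> real \<Rightarrow> real \<Rightarrow> real \<Rightarrow> generator" where
  "scaling_gen n a c d t0 s0 = zero_gen\<lparr>ct := \<lambda>t. a * t + t0,
     cs := \<lambda>s. (d + real (n + 1) * (a + c)) * s + s0,
     cu := \<lambda>t s u r. c * u, cr := \<lambda>t s u r. (a + c) * r,
     crho := \<lambda>t s \<rho> p. d * \<rho>, cp := \<lambda>t s \<rho> p. (2 * c + d) * p\<rparr>"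

lemma scheme_invariant_scaling_gen: "scheme_invariant n \<gamma> \<alpha> (scaling_gen n a c d t0 s0)"
  unfolding scheme_invariant_def
proof (intro allI impI ballI, elim conjE)
  fix I \<phi> x
  assume orb: "orbit n (scaling_gen n a c d t0 s0) I \<phi>"
    and z: "\<phi> 0 \<in> samarskii_popov n \<gamma> \<alpha>" and x: "x \<in> I"
  define b where "b = d + real (n + 1) * (a + c)"
  note odes = orb[unfolded orbit_def scaling_gen_def zero_gen_def, folded b_def, simplified]
  have "open I" "connected I" "0 \<in> I" using odes by auto
  note growth = exponential_growth[OF this x]
  have adm: "admissible n (\<phi> x)" using odes x by auto
  \<comment> \<open>The constant \<open>t0\<close> cancels in the difference of the layers, leaving
    a homogeneous linear equation; the same happens to \<open>s0\<close> for the mesh steps.\<close>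
  have tau: "tau (\<phi> x) = exp (a * x) * tau (\<phi> 0)"
  proof (rule growth)
    fix y assume y: "y \<in> I"
    have "((\<lambda>y. st_t (\<phi> y) j) has_real_derivative a * st_t (\<phi> y) j + t0) (at y)"
      if "j \<in> layers" for j
      using odes y that by auto
    from DERIV_diff[OF this[of 1] this[of 0]]
    show "((\<lambda>y. tau (\<phi> y)) has_real_derivative a * tau (\<phi> y)) (at y)"
      by (simp add: tau_def algebra_simps)
  qed
  have s: "st_s (\<phi> x) (k + 1) - st_s (\<phi> x) k
      = exp (b * x) * (st_s (\<phi> 0) (k + 1) - st_s (\<phi> 0) k)" if k: "k \<in> {-1, 0}" for k
  proof (rule growth)
    fix y assume y: "y \<in> I"
    have "((\<lambda>y. st_s (\<phi> y) l) has_real_derivative b * st_s (\<phi> y) l + s0) (at y)"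
      if "l \<in> s_nodes" for l
      using odes y that by auto
    from DERIV_diff[OF this[of "k + 1"] this[of k]] k
    show "((\<lambda>y. st_s (\<phi> y) (k + 1) - st_s (\<phi> y) k) has_real_derivative
        b * (st_s (\<phi> y) (k + 1) - st_s (\<phi> y) k)) (at y)"
      by (auto simp: algebra_simps)
  qed
  have u: "st_u (\<phi> x) k j = exp (c * x) * st_u (\<phi> 0) k j"
    and r: "st_r (\<phi> x) k j = exp ((a + c) * x) * st_r (\<phi> 0) k j"
    if "k \<in> nodes" "j \<in> layers" for k j
    by (rule growth; use odes that in auto)+
  have rho: "st_rho (\<phi> x) k j = exp (d * x) * st_rho (\<phi> 0) k j"
    and p: "st_p (\<phi> x) k j = exp ((2 * c + d) * x) * st_p (\<phi> 0) k j"
    if "k \<in> midpoints" "j \<in> layers" for k j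
    by (rule growth; use odes that in auto)+
  have AC: "exp (a * x) * exp (c * x) = exp ((a + c) * x)"
    by (simp add: algebra_simps flip: exp_add)
  have B: "exp (b * x) = exp (d * x) * (exp (a * x) * exp (c * x)) ^ (n + 1)"
    unfolding AC exp_of_nat_mult[symmetric] exp_add[symmetric]
    by (simp add: b_def algebra_simps)
  have P: "(exp (c * x))\<^sup>2 * exp (d * x) = exp ((2 * c + d) * x)"
    by (simp add: power2_eq_square algebra_simps flip: exp_add)
  show "\<phi> x \<in> samarskii_popov n \<gamma> \<alpha>"
    by (rule samarskii_popov_scale[OF z adm _ _ _ B tau s])
      (use u r rho p in \<open>auto simp: AC P\<close>)
qed

section \<open>Shift of the radius and Galilei boost for n = 0\<close>

definition boost_gen :: "real \<Rightarrow> real \<Rightarrow> generator" where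
  "boost_gen r0 v = zero_gen\<lparr>cr := \<lambda>t s u r. r0 + v * t, cu := \<lambda>t s u r. v\<rparr>"

lemma scheme_invariant_boost_gen: "scheme_invariant 0 \<gamma> \<alpha> (boost_gen r0 v)"
  unfolding scheme_invariant_def
proof (intro allI impI ballI, elim conjE)
  fix I \<phi> x
  assume orb: "orbit 0 (boost_gen r0 v) I \<phi>"
    and z: "\<phi> 0 \<in> samarskii_popov 0 \<gamma> \<alpha>" and x: "x \<in> I"
  note odes = orb[unfolded orbit_def boost_gen_def zero_gen_def, simplified]
  have I: "open I" "connected I" "0 \<in> I" using odes by auto
  note growth = linear_growth[OF I]
  have adm: "admissible 0 (\<phi> x)" using odes x by auto
  \<comment> \<open>This is needed along the whole orbit: it makes the coefficient of r constant
    there, so that r grows linearly.\<close>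
  have t: "st_t (\<phi> y) j = st_t (\<phi> 0) j" if "y \<in> I" "j \<in> layers" for y j
    using growth[OF that(1), of "\<lambda>y. st_t (\<phi> y) j" 0] odes that(2) by auto
  have s: "st_s (\<phi> x) k = st_s (\<phi> 0) k" if "k \<in> s_nodes" for k
    using growth[OF x, of "\<lambda>y. st_s (\<phi> y) k" 0] odes that by auto
  have u: "st_u (\<phi> x) k j = st_u (\<phi> 0) k j + v * x" if "k \<in> nodes" "j \<in> layers" for k j
    by (rule growth[OF x]) (use odes that in auto)
  have r: "st_r (\<phi> x) k j = st_r (\<phi> 0) k j + (r0 + v * st_t (\<phi> 0) j) * x"
    if "k \<in> nodes" "j \<in> layers" for k j
  proof (rule growth[OF x])
    fix y assume y: "y \<in> I"
    have "((\<lambda>y. st_r (\<phi> y) k j) has_real_derivative r0 + v * st_t (\<phi> y) j) (at y)"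
      using odes y that by auto
    then show "((\<lambda>y. st_r (\<phi> y) k j) has_real_derivative r0 + v * st_t (\<phi> 0) j) (at y)"
      by (simp add: t[OF y that(2)])
  qed
  have rho: "st_rho (\<phi> x) k j = st_rho (\<phi> 0) k j" and p: "st_p (\<phi> x) k j = st_p (\<phi> 0) k j"
    if "k \<in> midpoints" "j \<in> layers" for k j
    using growth[OF x, of "\<lambda>y. st_rho (\<phi> y) k j" 0] growth[OF x, of "\<lambda>y. st_p (\<phi> y) k j" 0]
      odes that by auto
  have tau: "tau (\<phi> x) = tau (\<phi> 0)" using x by (simp add: tau_def t)
  have tau_pos: "tau (\<phi> 0) > 0" using z by (simp add: samarskii_popov_def admissible_def)
  have R: "R_node 0 z k = 1" for z k by (simp add: R_node_def R_quot_explicit)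
  have w: "weighted (1/2) (st_u (\<phi> x)) k = weighted (1/2) (st_u (\<phi> 0)) k + v * x"
    if "k \<in> nodes" for k
    using that by (auto simp: weighted_def u algebra_simps)
  have wp: "weighted \<alpha> (st_p (\<phi> x)) k = weighted \<alpha> (st_p (\<phi> 0)) k" if "k \<in> midpoints" for k
    using that by (auto simp: weighted_def p)
  \<comment> \<open>The uniform shift cancels and the boost contributes \<open>v * x * tau\<close>
    over one step, so the left-hand side gains \<open>v * x\<close>, exactly as the mean velocity
    does.\<close>
  have r_t: "diff_t (\<phi> x) (st_r (\<phi> x)) 0 = diff_t (\<phi> 0) (st_r (\<phi> 0)) 0 + v * x"
  proof -
    have "st_r (\<phi> x) 0 1 - st_r (\<phi> x) 0 0
        = st_r (\<phi> 0) 0 1 - st_r (\<phi> 0) 0 0 + v * x * tau (\<phi> 0)"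
      by (simp add: r tau_def algebra_simps)
    then show ?thesis using tau_pos by (simp add: diff_t_def tau add_divide_distrib)
  qed
  have "diff_s (\<phi> x) (\<lambda>k. weighted (1/2) (st_u (\<phi> x)) k) 0
      = diff_s (\<phi> 0) (\<lambda>k. weighted (1/2) (st_u (\<phi> 0)) k) 0"
    by (simp add: diff_s_def w hs_def s)
  moreover have "diff_sbar (\<phi> x) (weighted \<alpha> (st_p (\<phi> x))) 0
      = diff_sbar (\<phi> 0) (weighted \<alpha> (st_p (\<phi> 0))) 0"
    by (simp add: diff_sbar_def wp hs_def s)
  moreover have "diff_t (\<phi> x) (eps \<gamma> (\<phi> x)) 0 = diff_t (\<phi> 0) (eps \<gamma> (\<phi> 0)) 0"
    "diff_t (\<phi> x) (\<lambda>k j. 1 / st_rho (\<phi> x) k j) 0 = diff_t (\<phi> 0) (\<lambda>k j. 1 / st_rho (\<phi> 0) k j) 0"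
    "diff_t (\<phi> x) (st_u (\<phi> x)) 0 = diff_t (\<phi> 0) (st_u (\<phi> 0)) 0"
    by (simp_all add: diff_t_def eps_def tau u rho p)
  ultimately show "\<phi> x \<in> samarskii_popov 0 \<gamma> \<alpha>"
    using z adm by (simp add: samarskii_popov_def R r_t w wp s)
qed

section \<open>A concrete orbit of the last generator that leaves the scheme\<close>

text \<open>
  The orbit starts from a state with \<open>\<tau> = h\<^sup>s = 1\<close>, resting radii \<open>r = 1\<close>, density 1 and
  pressures 1 and 3 on the two sides of the node 0, whose velocity jumps from 1 to \<open>-1\<close>.
  The flow multiplies \<open>t\<close> and \<open>r\<close> by \<open>1 / (1 - a t\<^sub>0)\<close> and maps \<open>u\<close> to \<open>u\<^sub>0 (1 - a t\<^sub>0) + a r\<^sub>0\<close>.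
\<close>

definition star_orbit :: "nat \<Rightarrow> real \<Rightarrow> stencil" where
  "star_orbit n a = \<lparr>st_t = (\<lambda>j. real j / (1 - a * real j)), st_s = (\<lambda>k. real_of_int k),
     st_u = (\<lambda>k j. (if k = 0 then 1 - 2 * real j else 0) * (1 - a * real j) + a),
     st_r = (\<lambda>k j. 1 / (1 - a * real j)),
     st_rho = (\<lambda>k j. (1 - a * real j) ^ (n + 1)),
     st_p = (\<lambda>k j. (if k = 0 then 3 else 1) * (1 - a * real j) ^ (n + 3))\<rparr>"

text \<open>On this interval \<open>1 - a * t\<close> stays positive for both initial times 0 and 1,
  so the orbit stays finite and admissible.\<close>

lemma orbit_star_orbit: "orbit n (X_star n) {-1<..<1} (star_orbit n)"
proof -
  \<comment> \<open>The derivatives are written through the transformed time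
    \<open>t / (1 - a * t)\<close>, the form in which the coefficients of the generator see
    them.\<close>
  have power_deriv: "((\<lambda>b. q * (1 - b * t) ^ Suc m) has_real_derivative
      - real (Suc m) * (t / (1 - a * t)) * (q * (1 - a * t) ^ Suc m)) (at a)"
    if "1 - a * t \<noteq> 0" for a t q :: real and m
    by (rule derivative_eq_intros refl | use that in \<open>simp add: field_simps\<close>)+
  have inverse_deriv: "((\<lambda>b. q / (1 - b * t)) has_real_derivative
      (t / (1 - a * t)) * (q / (1 - a * t))) (at a)" if "1 - a * t \<noteq> 0" for a t q :: real
    by (rule derivative_eq_intros refl | use that in \<open>simp add: field_simps power2_eq_square\<close>)+
  have u_deriv: "((\<lambda>b. q * (1 - b * t) + b) has_real_derivative
      1 / (1 - a * t) - (t / (1 - a * t)) * (q * (1 - a * t) + a)) (at a)"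
    if "1 - a * t \<noteq> 0" for a t q :: real
    by (rule derivative_eq_intros refl | use that in \<open>simp add: field_simps\<close>)+
  have pos: "1 - a * real j > 0" if "a \<in> {-1<..<1}" "j \<in> layers" for a j
    using that by auto
  have adm: "admissible n (star_orbit n a)" if "a \<in> {-1<..<1}" for a
    using that by (auto simp: admissible_def star_orbit_def tau_def hs_def)
  show ?thesis
    unfolding orbit_def
  proof (intro conjI ballI)
    fix a :: real assume a: "a \<in> {-1<..<1}"
    show "admissible n (star_orbit n a)" using adm[OF a] .
    fix j assume "j \<in> layers"
    then have nz: "1 - a * real j \<noteq> 0" using pos[OF a] by force
    show "((\<lambda>b. st_t (star_orbit n b) j) has_real_derivative
        ct (X_star n) (st_t (star_orbit n a) j)) (at a)"
      using inverse_deriv[OF nz, of "real j"]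
      by (simp add: star_orbit_def X_star_def power2_eq_square)
    fix k :: int
    show "((\<lambda>b. st_u (star_orbit n b) k j) has_real_derivative
        cu (X_star n) (st_t (star_orbit n a) j) (st_s (star_orbit n a) k)
          (st_u (star_orbit n a) k j) (st_r (star_orbit n a) k j)) (at a)"
      using u_deriv[OF nz, of "if k = 0 then 1 - 2 * real j else 0"]
      by (simp add: star_orbit_def X_star_def)
    show "((\<lambda>b. st_r (star_orbit n b) k j) has_real_derivative
        cr (X_star n) (st_t (star_orbit n a) j) (st_s (star_orbit n a) k)
          (st_u (star_orbit n a) k j) (st_r (star_orbit n a) k j)) (at a)"
      using inverse_deriv[OF nz, of 1] by (simp add: star_orbit_def X_star_def)
    show "((\<lambda>b. st_rho (star_orbit n b) k j) has_real_derivative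
        crho (X_star n) (st_t (star_orbit n a) j) (s_mid (star_orbit n a) k)
          (st_rho (star_orbit n a) k j) (st_p (star_orbit n a) k j)) (at a)"
      using power_deriv[OF nz, of 1 n] by (simp add: star_orbit_def X_star_def)
    show "((\<lambda>b. st_p (star_orbit n b) k j) has_real_derivative
        cp (X_star n) (st_t (star_orbit n a) j) (s_mid (star_orbit n a) k)
          (st_rho (star_orbit n a) k j) (st_p (star_orbit n a) k j)) (at a)"
      \<comment> \<open>The exponent is the successor of the parameter, so \<open>n + 2\<close>
        yields the power \<open>n + 3\<close> of the pressure.\<close>
      using power_deriv[OF nz, of "if k = 0 then 3 else 1" "n + 2"]
      by (simp add: star_orbit_def X_star_def numeral_3_eq_3)
  next
    fix a :: real and k :: int
    show "((\<lambda>b. st_s (star_orbit n b) k) has_real_derivative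
        cs (X_star n) (st_s (star_orbit n a) k)) (at a)"
      by (simp add: star_orbit_def X_star_def zero_gen_def)
  qed auto
qed

text \<open>The velocities 1 and -1 at node 0 average to zero and node 1 is at rest, so radii,
  densities and energies stay constant. With R = 1 the velocity change -2 balances the pressure jump
  3 - 1; the pressures agree on both layers, so the weight \<alpha> does not affect this
  jump.\<close>

lemma star_orbit_start: "star_orbit n 0 \<in> samarskii_popov n \<gamma> \<alpha>"
  by (auto simp: star_orbit_def samarskii_popov_def admissible_def tau_def hs_def diff_t_def
      diff_s_def diff_sbar_def weighted_def eps_def R_node_def R_quot_def algebra_simps)

text \<open>The radius equation fails at node 0: the layers are now 0 and 2 with radii 1 and 2, so
  the difference quotient is 1/2, while the velocities 3/2 and 0 have mean 3/4.\<close>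

lemma star_orbit_leaves: "star_orbit n (1/2) \<notin> samarskii_popov n \<gamma> \<alpha>"
  by (simp add: star_orbit_def samarskii_popov_def tau_def diff_t_def weighted_def)

lemma not_scheme_invariant_X_star: "\<not> scheme_invariant n \<gamma> \<alpha> (X_star n)"
proof
  assume "scheme_invariant n \<gamma> \<alpha> (X_star n)"
  then have "star_orbit n a \<in> samarskii_popov n \<gamma> \<alpha>" if "a \<in> {-1<..<1}" for a
    using orbit_star_orbit star_orbit_start that unfolding scheme_invariant_def by blast
  from this[of "1/2"] show False using star_orbit_leaves by simp
qed

theorem mainTheorem8:
  fixes n :: nat and \<gamma> \<alpha> :: real
  assumes "n \<in> {0, 1, 2}" and "\<gamma> > 1" and "0 \<le> \<alpha>" and "\<alpha> \<le> 1"
  shows "(\<forall>X\<in>{X0, X1, X2 n, X3 n, X4}. scheme_invariant n \<gamma> \<alpha> X) \<and>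
    (n = 0 \<longrightarrow> scheme_invariant n \<gamma> \<alpha> X_shift_r \<and> scheme_invariant n \<gamma> \<alpha> X_galilei) \<and>
    (\<gamma> = real (n + 3) / real (n + 1) \<longrightarrow> \<not> scheme_invariant n \<gamma> \<alpha> (X_star n))"
proof -
  \<comment> \<open>The arguments after \<open>n\<close> are the rates of t, u, \<rho> and the
    shifts of t and s. For \<open>X3\<close> the rates 2, -1, 2 force n + 3 for s, 1 for r and 0 for
    p.\<close>
  have scalings: "X0 = scaling_gen n 0 0 0 0 1" "X1 = scaling_gen n 0 0 0 1 0"
    "X2 n = scaling_gen n 1 0 0 0 0" "X3 n = scaling_gen n 2 (-1) 2 0 0"
    "X4 = scaling_gen n 0 0 1 0 0"
    by (simp_all add: X0_def X1_def X2_def X3_def X4_def scaling_gen_def zero_gen_def add.commute)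
  have boosts: "X_shift_r = boost_gen 1 0" "X_galilei = boost_gen 0 1"
    by (simp_all add: X_shift_r_def X_galilei_def boost_gen_def zero_gen_def)
  show ?thesis
    by (simp add: scalings boosts scheme_invariant_scaling_gen scheme_invariant_boost_gen
        not_scheme_invariant_X_star)
qed

end
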